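(* Let $F$, $f$, $(\xi_k)_{k\in\mathbb N}$, $G$, $H$, $(\alpha_k)_{k\in\mathbb N}$ and $(w_k)_{k\in\mathbb N}$ be as in the context, and suppose that (A1), (A2), (A3) hold. Let $i\in\{1,2\}$. If $i=1$, suppose that there is $w_*\in\arg\min_{w\in\mathbb R^d}F(w)$ satisfying both (A4) and (A6); if $i=2$, suppose that there is $w_*\in\arg\min_{w\in\mathbb R^d}F(w)$ satisfying both (A5) and (A6). Then for every $K\in\mathbb N$ $$\min_{1\le k\le K}\mathbb E\big[\|\nabla F(w_k)\|^2\big]\le \frac{F(w_1)-F(w_* )}{\sum_{k=1}^K\alpha_k}+B_i\,\frac{\sum_{k=1}^K\alpha_k^2}{\sum_{k=1}^K\alpha_k},$$ where $$B_1=2c_hL^3M+2c_hLM^{1/3}\sigma^2+c_g^2L^3M^{2/3}+c_g^2L\sigma^2,\qquad B_2=c_hL^3M+\frac{c_g^2L^3}{2}M^{2/3}.$$ In particular, if $\sum_{k=1}^\infty\alpha_k^2<\infty$ and $\sum_{k=1}^\infty\alpha_k=\infty$, then $$\lim_{K\to\infty}\min_{1\le k\le K}\mathbb E\big[\|\nabla F(w_k)\|^2\big]=0.$$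
   Context: Notation: $\|\cdot\|$ is the Euclidean norm on $\mathbb R^d$, $d\in\mathbb N$; $\mathbb N=\{1,2,\dots\}$; $\mathbb R^+$ denotes the positive reals and $\mathbb R^+_0$ the non-negative reals. $(\Omega,\mathcal F,\mathbb P)$ is a complete probability space; $(\xi_k)_{k\in\mathbb N}$ is a sequence of independent, identically distributed random variables on $\Omega$, and $\xi$ denotes a random variable with their common distribution. The objective function is $F:\mathbb R^d\to\mathbb R$, $F(w)=\mathbb E[f(w,\xi)]$. Method: given functions $G,H:\mathbb R^d\times\mathbb R^+\to\mathbb R^d$ with $G(x,\alpha)=x-\alpha H(x,\alpha)$, step sizes $\alpha_k\in\mathbb R^+$ and a (deterministic) initial value $w_1\in\mathbb R^d$, the sequence $(w_k)_{k\in\mathbb N}$ is generated by $$w_{k+1}=w_k-\alpha_kG(\nabla f(w_k,\xi_k),\alpha_k)=w_k-\alpha_k\nabla f(w_k,\xi_k)+\alpha_k^2H(\nabla f(w_k,\xi_k),\alpha_k).$$ Assumptions: (A1) There are constants $c_g\in\mathbb R^+$ and $c_h\in\mathbb R^+_0$ such that $\|G(x,\alpha)\|\le c_g\|x\|$ and $\|H(x,\alpha)\|\le c_h\|x\|^2$ for all $x\in\mathbb R^d$, $\alpha\in\mathbb R^+$. (A2) (Unbiased gradients) The stochastic gradient $\nabla f(\cdot,\xi)$ satisfies $\mathbb E[\nabla f(v,\xi)]=\nabla F(v)$ for all $v\in\mathbb R^d$. (A3) (Lipschitz gradients) $F$ is continuously differentiable and $\|\nabla F(v)-\nabla F(w)\|\le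 L\|v-w\|$ for all $v,w\in\mathbb R^d$, with $L\in\mathbb R^+$. Moreover there is a $\sigma(\xi)$-measurable, square-integrable random variable $L_\xi$ with values in $\mathbb R^+$ such that almost surely $\|\nabla f(v,\xi)-\nabla f(w,\xi)\|\le L_\xi\|v-w\|$ for all $v,w\in\mathbb R^d$, and $\mathbb E[L_\xi^2]\le L^2$. (A4) (Bounded variance, for $w_*\in\arg\min F$) $\mathbb E[\|\nabla f(w_*,\xi)\|^2]\le\sigma^2$. (A5) (Interpolation, for $w_*\in\arg\min F$) almost surely $w_*\in\arg\min_{w\in\mathbb R^d}f(w,\xi)$; in particular $\nabla f(w_*,\xi)=0$ almost surely. (A6) (Moment bound, for $w_*$) there is $M\in\mathbb R^+$ with $\mathbb E[\|w_k-w_*\|^3]\le M$ for every $k\in\mathbb N$. *)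

theory Defs
  imports "HOL-Probability.Probability"
begin

(* Meaningful where h is differentiable; elsewhere the value is unspecified. *)
definition grad :: "('v::real_inner \<Rightarrow> real) \<Rightarrow> 'v \<Rightarrow> 'v" where
  "grad h x = (THE D. GDERIV h x :> D)"

definition C1_everywhere :: "('v::real_inner \<Rightarrow> real) \<Rightarrow> bool" where
  "C1_everywhere h \<longleftrightarrow> (\<forall>x. h differentiable (at x)) \<and> continuous_on UNIV (grad h)"

definition B1 :: "real \<Rightarrow> real \<Rightarrow> real \<Rightarrow> real \<Rightarrow> real \<Rightarrow> real" where
  "B1 c\<^sub>g c\<^sub>h L M \<sigma> =
     2 * c\<^sub>h * L^3 * M + 2 * c\<^sub>h * L * M powr (1/3) * \<sigma>^2
     + c\<^sub>g^2 * L^3 * M powr (2/3) + c\<^sub>g^2 * L * \<sigma>^2"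

definition B2 :: "real \<Rightarrow> real \<Rightarrow> real \<Rightarrow> real \<Rightarrow> real" where
  "B2 c\<^sub>g c\<^sub>h L M = c\<^sub>h * L^3 * M + (c\<^sub>g^2 * L^3 / 2) * M powr (2/3)"

end

theory Submission
  imports Defs
begin

text \<open>
  Expanding the descent lemma along one step gives, with \<open>g\<^sub>k\<close> the stochastic gradient at \<open>w\<^sub>k\<close>, a bound
  on \<open>F(w\<^sub>k\<^sub>+\<^sub>1) - F(w\<^sub>k)\<close> by \<open>- \<alpha>\<^sub>k \<nabla>F(w\<^sub>k) \<bullet> g\<^sub>k\<close> plus \<open>\<alpha>\<^sub>k\<^sup>2\<close> times a combination of
  \<open>\<parallel>w\<^sub>k - w\<^sub>*\<parallel> \<parallel>g\<^sub>k\<parallel>\<^sup>2\<close> and \<open>\<parallel>g\<^sub>k\<parallel>\<^sup>2\<close>. Since \<open>w\<^sub>k\<close> depends only on the samples before \<open>k\<close>, the joint law of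
  \<open>(w\<^sub>k, \<xi>\<^sub>k)\<close> is a product, so one may integrate over \<open>\<xi>\<^sub>k\<close> first: the linear term becomes
  \<open>- \<alpha>\<^sub>k \<parallel>\<nabla>F(w\<^sub>k)\<parallel>\<^sup>2\<close>, and \<open>\<parallel>g\<^sub>k\<parallel>\<^sup>2\<close> is bounded by \<open>a \<parallel>w\<^sub>k - w\<^sub>*\<parallel>\<^sup>2 + b\<close>, where \<open>(a, b)\<close> is
  \<open>(2 L\<^sup>2, 2 \<sigma>\<^sup>2)\<close> or \<open>(L\<^sup>2, 0)\<close>. The third moment bound controls all that remains, and summing over \<open>k\<close>
  telescopes.
\<close>

section \<open>Gradients and the quadratic upper bound for Lipschitz gradients\<close>

text \<open>Two vectors that induce the same linear functional coincide: their difference, tested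
  against itself, has norm zero. This uniqueness makes the definite description in
  \<open>grad\<close> usable.\<close>

lemma grad_eqI:
  assumes "GDERIV h x :> D"
  shows "grad h x = D"
  unfolding grad_def
proof (rule the_equality)
  fix D' assume "GDERIV h x :> D'"
  then have "(\<lambda>v. v \<bullet> D') = (\<lambda>v. v \<bullet> D)"
    using assms unfolding gderiv_def by (rule has_derivative_unique)
  then have "v \<bullet> (D' - D) = 0" for v
    by (metis inner_diff_right right_minus_eq)
  then show "D' = D"
    by (metis inner_eq_zero_iff right_minus_eq)
qed fact

text \<open>In finite dimension a linear functional is the inner product with the vector of its
  values on the basis, so plain differentiability already provides a gradient.\<close>

lemma GDERIV_grad:
  fixes h :: "'v::euclidean_space \<Rightarrow> real"
  assumes "h differentiable (at x)"
  shows "GDERIV h x :> grad h x"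
proof -
  obtain h' where h': "(h has_derivative h') (at x)"
    using assms by (auto simp: differentiable_def)
  interpret bounded_linear h'
    using h' by (rule has_derivative_bounded_linear)
  have "h' = (\<lambda>v. v \<bullet> (\<Sum>b\<in>Basis. h' b *\<^sub>R b))"
  proof
    fix v
    have "h' v = h' (\<Sum>b\<in>Basis. (v \<bullet> b) *\<^sub>R b)"
      by (simp add: euclidean_representation)
    also have "\<dots> = (\<Sum>b\<in>Basis. (v \<bullet> b) * h' b)"
      by (simp add: sum scaleR)
    also have "\<dots> = v \<bullet> (\<Sum>b\<in>Basis. h' b *\<^sub>R b)"
      by (simp add: inner_sum_right mult.commute)
    finally show "h' v = v \<bullet> (\<Sum>b\<in>Basis. h' b *\<^sub>R b)" .
  qed
  with h' have "GDERIV h x :> (\<Sum>b\<in>Basis. h' b *\<^sub>R b)"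
    by (simp add: gderiv_def)
  then show ?thesis
    using grad_eqI by metis
qed

lemma grad_argmin_eq_0:
  fixes h :: "'v::euclidean_space \<Rightarrow> real"
  assumes "h differentiable (at x)" and "is_arg_min h (\<lambda>_. True) x"
  shows "grad h x = 0"
proof -
  have "\<forall>y\<in>UNIV. h x \<le> h y"
    using assms(2) by (auto simp: is_arg_min_linorder)
  then have "(\<lambda>v. v \<bullet> grad h x) = (\<lambda>v. 0)"
    using GDERIV_grad[OF assms(1)]
    by (intro differential_zero_maxmin[of x UNIV h]) (auto simp: gderiv_def)
  then show ?thesis
    by (metis inner_eq_zero_iff)
qed

lemma GDERIV_DERIV_line:
  fixes h :: "'v::real_inner \<Rightarrow> real"
  assumes "GDERIV h (x + t *\<^sub>R d) :> D"
  shows "((\<lambda>t. h (x + t *\<^sub>R d)) has_real_derivative d \<bullet> D) (at t)"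
proof -
  have "((\<lambda>t. x + t *\<^sub>R d) has_derivative (\<lambda>s. s *\<^sub>R d)) (at t)"
    by (auto intro!: derivative_eq_intros)
  from has_derivative_compose[OF this, of h "\<lambda>v. v \<bullet> D"] assms
  have "((\<lambda>t. h (x + t *\<^sub>R d)) has_derivative (\<lambda>s. (s *\<^sub>R d) \<bullet> D)) (at t)"
    by (simp add: gderiv_def)
  moreover have "(\<lambda>s. (s *\<^sub>R d) \<bullet> D) = (*) (d \<bullet> D)"
    by (simp add: fun_eq_iff)
  ultimately show ?thesis
    by (simp only: has_field_derivative_def)
qed

text \<open>Along the segment from \<open>x\<close> to \<open>x + d\<close>, subtract from
  \<open>h\<close> its linear part and the quadratic \<open>L / 2 * t^2 * norm d ^ 2\<close>. By
  Cauchy-Schwarz and the Lipschitz bound the remainder has nonpositive derivative for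
  \<open>t\<close> at least 0; comparing \<open>t = 0\<close> with \<open>t = 1\<close> gives the
  sharp factor \<open>L / 2\<close> without integrating the gradient.\<close>

lemma descent_lemma:
  fixes h :: "'v::euclidean_space \<Rightarrow> real"
  assumes diff: "\<And>x. h differentiable (at x)"
    and lip: "\<And>u v. norm (grad h u - grad h v) \<le> L * norm (u - v)"
  shows "h (x + d) \<le> h x + d \<bullet> grad h x + L / 2 * norm d ^ 2"
proof -
  define \<phi> where "\<phi> t = h (x + t *\<^sub>R d) - t * (d \<bullet> grad h x) - L / 2 * t^2 * norm d ^ 2" for t
  have deriv: "\<exists>y. (\<phi> has_real_derivative y) (at t) \<and> y \<le> 0" if t: "0 \<le> t" for t
  proof -
    let ?y = "d \<bullet> grad h (x + t *\<^sub>R d) - d \<bullet> grad h x - L * t * norm d ^ 2"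
    have "(\<phi> has_real_derivative ?y) (at t)"
      unfolding \<phi>_def
      by (rule derivative_eq_intros GDERIV_DERIV_line GDERIV_grad diff refl | simp)+
    moreover have "d \<bullet> grad h (x + t *\<^sub>R d) - d \<bullet> grad h x \<le> L * t * norm d ^ 2"
    proof -
      have "d \<bullet> (grad h (x + t *\<^sub>R d) - grad h x)
          \<le> norm d * norm (grad h (x + t *\<^sub>R d) - grad h x)"
        by (rule norm_cauchy_schwarz)
      also have "\<dots> \<le> norm d * (L * norm ((x + t *\<^sub>R d) - x))"
        by (intro mult_left_mono lip) simp
      also have "\<dots> = L * t * norm d ^ 2"
        using t by (simp add: power2_eq_square)
      finally show ?thesis
        by (simp add: inner_diff_right)
    qed
    ultimately show ?thesis
      by (intro exI[of _ ?y]) simp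
  qed
  have "\<phi> 0 \<ge> \<phi> 1"
    by (rule DERIV_nonpos_imp_nonincreasing) (auto intro: deriv)
  then show ?thesis
    by (simp add: \<phi>_def)
qed

section \<open>Joint measurability of the stochastic gradient\<close>

text \<open>Approximate the first argument by simple functions \<open>r n\<close> of it. Each
  \<open>r n\<close> takes finitely many values, so measurability in \<open>s\<close> for fixed
  \<open>v\<close> is enough, and continuity in \<open>v\<close> carries it to the limit.\<close>

lemma borel_measurable_caratheodory:
  fixes f :: "'v::{metric_space, second_countable_topology} \<Rightarrow> 's \<Rightarrow> real"
  assumes cont: "\<And>s. s \<in> space S \<Longrightarrow> continuous_on UNIV (\<lambda>v. f v s)"
    and meas: "\<And>v. f v \<in> borel_measurable S"
  shows "(\<lambda>(v, s). f v s) \<in> borel_measurable (borel \<Otimes>\<^sub>M S)"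
proof -
  \<comment> \<open>The base point \<open>undefined\<close> is arbitrary: it is the centre of a
    growth bound that accompanies the approximating sequence.\<close>
  obtain r :: "nat \<Rightarrow> 'v \<Rightarrow> 'v" where r: "\<And>n. simple_function borel (r n)"
    and lim: "\<And>v. (\<lambda>n. r n v) \<longlonglongrightarrow> v"
    using borel_measurable_implies_sequence_metric[of "\<lambda>v. v" "borel :: 'v measure" undefined]
    by auto
  have "(\<lambda>p. f (r n (fst p)) (snd p)) \<in> borel_measurable (borel \<Otimes>\<^sub>M S)" for n
  proof (rule measurable_compose_countable'[where I = "range (r n)"])
    show "(\<lambda>p. f v (snd p)) \<in> borel_measurable (borel \<Otimes>\<^sub>M S)" for v
      using meas by measurable
    have "r n \<in> measurable borel (count_space (range (r n)))"
      using measurable_simple_function[OF r[of n]]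
      by (auto simp: measurable_def)
    then show "(\<lambda>p. r n (fst p)) \<in> measurable (borel \<Otimes>\<^sub>M S) (count_space (range (r n)))"
      by (rule measurable_compose[OF measurable_fst])
    show "countable (range (r n))"
      using simple_functionD(1)[OF r[of n]] by (simp add: countable_finite)
  qed
  moreover have "(\<lambda>n. f (r n (fst p)) (snd p)) \<longlonglongrightarrow> f (fst p) (snd p)"
    if "p \<in> space (borel \<Otimes>\<^sub>M S)" for p
    using that cont lim by (auto simp: space_pair_measure intro!: continuous_on_tendsto_compose[OF cont])
  ultimately show ?thesis
    unfolding case_prod_beta by (rule borel_measurable_LIMSEQ_real[rotated])
qed

text \<open>Each partial derivative is a pointwise limit of jointly measurable difference quotients.\<close>
lemma borel_measurable_grad:
  fixes f :: "'v::euclidean_space \<Rightarrow> 's \<Rightarrow> real"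
  assumes diff: "\<And>v s. s \<in> space S \<Longrightarrow> (\<lambda>u. f u s) differentiable (at v)"
    and meas: "\<And>v. f v \<in> borel_measurable S"
  shows "(\<lambda>(v, s). grad (\<lambda>u. f u s) v) \<in> borel_measurable (borel \<Otimes>\<^sub>M S)"
proof (rule iffD2[OF borel_measurable_euclidean_space], rule ballI)
  fix b :: 'v assume "b \<in> Basis"
  have "continuous_on UNIV (\<lambda>v. f v s)" if "s \<in> space S" for s
    using diff[OF that] by (simp add: continuous_on_eq_continuous_at differentiable_imp_continuous_within)
  then have f[measurable]: "(\<lambda>(v, s). f v s) \<in> borel_measurable (borel \<Otimes>\<^sub>M S)"
    using meas by (rule borel_measurable_caratheodory)
  \<comment> \<open>The increments 1/(n+1) are never zero, so they approach 0 within the filter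
    \<open>at 0\<close>, as composing with the derivative limit requires.\<close>
  let ?t = "\<lambda>n. inverse (real (Suc n))"
  let ?q = "\<lambda>n p. (f (fst p + ?t n *\<^sub>R b) (snd p) - f (fst p) (snd p)) / ?t n"
  have f': "(\<lambda>p. f (\<psi> p) (snd p)) \<in> borel_measurable (borel \<Otimes>\<^sub>M S)"
    if "\<psi> \<in> measurable (borel \<Otimes>\<^sub>M S) borel" for \<psi>
    using measurable_compose[OF measurable_Pair[OF that measurable_snd] f] by simp
  have q: "?q n \<in> borel_measurable (borel \<Otimes>\<^sub>M S)" for n
    by (intro borel_measurable_divide borel_measurable_diff f') measurable
  show "(\<lambda>p. (case p of (v, s) \<Rightarrow> grad (\<lambda>u. f u s) v) \<bullet> b) \<in> borel_measurable (borel \<Otimes>\<^sub>M S)"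
  proof (rule borel_measurable_LIMSEQ_real[OF _ q])
    fix p :: "'v \<times> 's" assume "p \<in> space (borel \<Otimes>\<^sub>M S)"
    then obtain v s where p: "p = (v, s)" and s: "s \<in> space S"
      by (auto simp: space_pair_measure)
    have "((\<lambda>t. f (v + t *\<^sub>R b) s) has_real_derivative b \<bullet> grad (\<lambda>u. f u s) v) (at 0)"
      using GDERIV_grad[OF diff[OF s, of v]] by (intro GDERIV_DERIV_line) simp
    then have "(\<lambda>t. (f (v + t *\<^sub>R b) s - f v s) / t) \<midarrow>0\<rightarrow> b \<bullet> grad (\<lambda>u. f u s) v"
      by (simp add: DERIV_def)
    moreover have "filterlim ?t (at 0) sequentially"
      using LIMSEQ_inverse_real_of_nat by (auto simp: filterlim_at)
    ultimately show "(\<lambda>n. ?q n p) \<longlonglongrightarrow> (case p of (v, s) \<Rightarrow> grad (\<lambda>u. f u s) v) \<bullet> b"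
      unfolding p by (auto simp: inner_commute dest: filterlim_compose)
  qed
qed

section \<open>First and second moments from the third\<close>

text \<open>For nonnegative \<open>x\<close>, both \<open>x\<close> and \<open>x ^ 2\<close> are
  dominated by affine functions of \<open>x ^ 3\<close>, which yields integrability and the bound
  together. With \<open>t\<close> the cube root of the third moment bound, this produces the
  fractional powers of \<open>M\<close> in the final constants.\<close>

lemma (in prob_space) moment_bounds_from_cube:
  fixes X :: "'a \<Rightarrow> real"
  assumes [measurable]: "X \<in> borel_measurable M" and nonneg: "\<And>\<omega>. 0 \<le> X \<omega>"
    and int: "integrable M (\<lambda>\<omega>. X \<omega> ^ 3)" and le: "expectation (\<lambda>\<omega>. X \<omega> ^ 3) \<le> t ^ 3" and t: "t > 0"
  shows "integrable M X" and "expectation X \<le> t"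
    and "integrable M (\<lambda>\<omega>. X \<omega> ^ 2)" and "expectation (\<lambda>\<omega>. X \<omega> ^ 2) \<le> t ^ 2"
proof -
  let ?u = "\<lambda>\<omega>. X \<omega> ^ 3 / (3 * t ^ 2) + 2 * t / 3"
  let ?v = "\<lambda>\<omega>. 2 * X \<omega> ^ 3 / (3 * t) + t ^ 2 / 3"
  \<comment> \<open>Both bounds are tangent at \<open>x = t\<close>, so no constant is lost against Jensen's inequality.\<close>
  have u: "x \<le> x ^ 3 / (3 * t ^ 2) + 2 * t / 3" if "x \<ge> 0" for x
  proof -
    have "0 \<le> (x - t)\<^sup>2 * (x + 2 * t)" using that t by simp
    also have "\<dots> = x ^ 3 + 2 * t ^ 3 - 3 * t ^ 2 * x"
      by (simp add: power2_eq_square power3_eq_cube algebra_simps)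
    finally show ?thesis using t by (simp add: field_simps power2_eq_square power3_eq_cube)
  qed
  have v: "x ^ 2 \<le> 2 * x ^ 3 / (3 * t) + t ^ 2 / 3" if "x \<ge> 0" for x
  proof -
    have "0 \<le> (x - t)\<^sup>2 * (2 * x + t)" using that t by simp
    also have "\<dots> = 2 * x ^ 3 + t ^ 3 - 3 * t * x ^ 2"
      by (simp add: power2_eq_square power3_eq_cube algebra_simps)
    finally show ?thesis using t by (simp add: field_simps power2_eq_square power3_eq_cube)
  qed
  have iu: "integrable M ?u" and iv: "integrable M ?v"
    using int by auto
  show i1: "integrable M X"
    by (rule Bochner_Integration.integrable_bound[OF iu])
       (use u nonneg in \<open>auto intro!: AE_I2 intro: order_trans[OF _ abs_ge_self]\<close>)
  show i2: "integrable M (\<lambda>\<omega>. X \<omega> ^ 2)"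
    by (rule Bochner_Integration.integrable_bound[OF iv])
       (use v nonneg in \<open>auto intro!: AE_I2 intro: order_trans[OF _ abs_ge_self]\<close>)
  have "expectation X \<le> expectation ?u"
    using i1 iu u nonneg by (intro integral_mono) auto
  also have "\<dots> = expectation (\<lambda>\<omega>. X \<omega> ^ 3) / (3 * t ^ 2) + 2 * t / 3"
    using int by (simp add: prob_space)
  also have "\<dots> \<le> t ^ 3 / (3 * t ^ 2) + 2 * t / 3"
    using le t by (intro add_mono divide_right_mono) auto
  also have "\<dots> = t" using t by (simp add: field_simps power2_eq_square power3_eq_cube)
  finally show "expectation X \<le> t" .
  have "expectation (\<lambda>\<omega>. X \<omega> ^ 2) \<le> expectation ?v"
    using i2 iv v nonneg by (intro integral_mono) auto
  also have "\<dots> = 2 * expectation (\<lambda>\<omega>. X \<omega> ^ 3) / (3 * t) + t ^ 2 / 3"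
    using int by (simp add: prob_space)
  also have "\<dots> \<le> 2 * t ^ 3 / (3 * t) + t ^ 2 / 3"
    using le t by (intro add_mono divide_right_mono) auto
  also have "\<dots> = t ^ 2" using t by (simp add: field_simps power2_eq_square power3_eq_cube)
  finally show "expectation (\<lambda>\<omega>. X \<omega> ^ 2) \<le> t ^ 2" .
qed

section \<open>Integration under a product law\<close>

text \<open>The image of a product measure under a coordinatewise map is the product of the images.
  Independence is recorded as an identity of laws because Fubini is applied in that form.\<close>

lemma (in prob_space) joint_law_compose:
  assumes indep: "indep_var A X B Y" and [measurable]: "\<Phi> \<in> measurable A A'" "\<Psi> \<in> measurable B B'"
  shows "distr M (A' \<Otimes>\<^sub>M B') (\<lambda>\<omega>. (\<Phi> (X \<omega>), \<Psi> (Y \<omega>)))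
    = distr M A' (\<lambda>\<omega>. \<Phi> (X \<omega>)) \<Otimes>\<^sub>M distr M B' (\<lambda>\<omega>. \<Psi> (Y \<omega>))"
proof -
  note [measurable] = indep_var_rv1[OF indep] indep_var_rv2[OF indep]
  \<comment> \<open>A probability measure is sigma-finite, which \<open>pair_measure_distr\<close>
    requires of the second image measure.\<close>
  interpret \<Psi>Y: prob_space "distr (distr M B Y) B' \<Psi>"
    by (intro prob_space.prob_space_distr prob_space_distr) measurable
  have "distr (distr M A X) A' \<Phi> \<Otimes>\<^sub>M distr (distr M B Y) B' \<Psi>
      = distr (distr M A X \<Otimes>\<^sub>M distr M B Y) (A' \<Otimes>\<^sub>M B') (\<lambda>(x, y). (\<Phi> x, \<Psi> y))"
    by (rule pair_measure_distr) (measurable, unfold_locales)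
  also have "distr M A X \<Otimes>\<^sub>M distr M B Y = distr M (A \<Otimes>\<^sub>M B) (\<lambda>\<omega>. (X \<omega>, Y \<omega>))"
    using indep by (simp add: indep_var_distribution_eq)
  finally show ?thesis
    by (simp add: distr_distr comp_def)
qed

text \<open>Fubini, pulled back to the probability space. It replaces conditioning on
  \<open>X\<close>: the inner integral freezes \<open>X\<close> at a point and averages over
  \<open>Y\<close> alone, so that facts about a fixed point apply.\<close>

lemma (in prob_space) product_law_integral:
  fixes h :: "'b \<times> 'c \<Rightarrow> real"
  assumes [measurable]: "random_variable A X" "random_variable B Y"
    and law: "distr M (A \<Otimes>\<^sub>M B) (\<lambda>\<omega>. (X \<omega>, Y \<omega>)) = distr M A X \<Otimes>\<^sub>M distr M B Y"
    and [measurable]: "h \<in> borel_measurable (A \<Otimes>\<^sub>M B)"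
    and int: "integrable M (\<lambda>\<omega>. h (X \<omega>, Y \<omega>))"
  shows "expectation (\<lambda>\<omega>. h (X \<omega>, Y \<omega>)) = (\<integral>\<omega>. (\<integral>\<omega>'. h (X \<omega>, Y \<omega>') \<partial>M) \<partial>M)"
proof -
  interpret X: prob_space "distr M A X" by (rule prob_space_distr) simp
  interpret Y: prob_space "distr M B Y" by (rule prob_space_distr) simp
  interpret XY: pair_prob_space "distr M A X" "distr M B Y" ..
  have "integrable (distr M A X \<Otimes>\<^sub>M distr M B Y) h"
    unfolding law[symmetric] using int by (simp add: integrable_distr_eq)
  then have "(\<integral>x. (\<integral>y. h (x, y) \<partial>distr M B Y) \<partial>distr M A X) = integral\<^sup>L (distr M A X \<Otimes>\<^sub>M distr M B Y) h"
    by (rule XY.integral_fst')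
  also have "\<dots> = expectation (\<lambda>\<omega>. h (X \<omega>, Y \<omega>))"
    unfolding law[symmetric] by (simp add: integral_distr)
  also have "(\<integral>x. (\<integral>y. h (x, y) \<partial>distr M B Y) \<partial>distr M A X)
      = (\<integral>\<omega>. (\<integral>y. h (X \<omega>, y) \<partial>distr M B Y) \<partial>M)"
    by (rule integral_distr) measurable
  also have "\<dots> = (\<integral>\<omega>. (\<integral>\<omega>'. h (X \<omega>, Y \<omega>') \<partial>M) \<partial>M)"
    by (intro Bochner_Integration.integral_cong refl integral_distr) (auto dest: measurable_space[OF assms(1)])
  finally show ?thesis ..
qed

text \<open>The Tonelli counterpart for nonnegative \<open>h\<close>: joint integrability is a
  conclusion here, obtained from the sectionwise bound, so the computation runs through extended
  nonnegative integrals.\<close>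

lemma (in prob_space) product_law_integral_le:
  fixes h :: "'b \<times> 'c \<Rightarrow> real" and \<beta> :: "'b \<Rightarrow> real"
  assumes [measurable]: "random_variable A X" "random_variable B Y"
    and law: "distr M (A \<Otimes>\<^sub>M B) (\<lambda>\<omega>. (X \<omega>, Y \<omega>)) = distr M A X \<Otimes>\<^sub>M distr M B Y"
    and [measurable]: "h \<in> borel_measurable (A \<Otimes>\<^sub>M B)"
    and nonneg: "\<And>p. 0 \<le> h p"
    and sect_int: "\<And>x. x \<in> space A \<Longrightarrow> integrable M (\<lambda>\<omega>. h (x, Y \<omega>))"
    and sect_le: "\<And>x. x \<in> space A \<Longrightarrow> expectation (\<lambda>\<omega>. h (x, Y \<omega>)) \<le> \<beta> x"
    and \<beta>: "integrable M (\<lambda>\<omega>. \<beta> (X \<omega>))"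
  shows "integrable M (\<lambda>\<omega>. h (X \<omega>, Y \<omega>))"
    and "expectation (\<lambda>\<omega>. h (X \<omega>, Y \<omega>)) \<le> expectation (\<lambda>\<omega>. \<beta> (X \<omega>))"
proof -
  note X_space = measurable_space[OF assms(1)]
  interpret Y: prob_space "distr M B Y" by (rule prob_space_distr) simp
  \<comment> \<open>The bound dominates the integral of a nonnegative section; its sign is needed to
    pass between real and extended integrals.\<close>
  have \<beta>_nonneg: "0 \<le> \<beta> (X \<omega>)" if "\<omega> \<in> space M" for \<omega>
    by (rule order_trans[OF Bochner_Integration.integral_nonneg sect_le[OF X_space[OF that]]]) (rule nonneg)
  have "(\<integral>\<^sup>+\<omega>. h (X \<omega>, Y \<omega>) \<partial>M) = (\<integral>\<^sup>+p. h p \<partial>(distr M A X \<Otimes>\<^sub>M distr M B Y))"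
    unfolding law[symmetric] by (simp add: nn_integral_distr)
  also have "\<dots> = (\<integral>\<^sup>+x. (\<integral>\<^sup>+y. h (x, y) \<partial>distr M B Y) \<partial>distr M A X)"
    by (rule Y.nn_integral_fst[symmetric]) measurable
  also have "\<dots> = (\<integral>\<^sup>+\<omega>. (\<integral>\<^sup>+y. h (X \<omega>, y) \<partial>distr M B Y) \<partial>M)"
    by (rule nn_integral_distr) measurable
  also have "\<dots> = (\<integral>\<^sup>+\<omega>. (\<integral>\<^sup>+\<omega>'. h (X \<omega>, Y \<omega>') \<partial>M) \<partial>M)"
    by (intro nn_integral_cong nn_integral_distr) (auto dest: X_space)
  also have "\<dots> \<le> (\<integral>\<^sup>+\<omega>. \<beta> (X \<omega>) \<partial>M)"
  proof (rule nn_integral_mono)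
    fix \<omega> assume "\<omega> \<in> space M"
    then have x: "X \<omega> \<in> space A" by (rule X_space)
    show "(\<integral>\<^sup>+\<omega>'. h (X \<omega>, Y \<omega>') \<partial>M) \<le> \<beta> (X \<omega>)"
      using nonneg sect_int[OF x] sect_le[OF x]
      by (subst nn_integral_eq_integral) (auto intro: ennreal_leI)
  qed
  also have "\<dots> = ennreal (expectation (\<lambda>\<omega>. \<beta> (X \<omega>)))"
    using \<beta> \<beta>_nonneg by (intro nn_integral_eq_integral) auto
  finally have le: "(\<integral>\<^sup>+\<omega>. h (X \<omega>, Y \<omega>) \<partial>M) \<le> ennreal (expectation (\<lambda>\<omega>. \<beta> (X \<omega>)))" .
  show int: "integrable M (\<lambda>\<omega>. h (X \<omega>, Y \<omega>))"
    using le nonneg by (intro integrableI_nonneg) (auto intro: le_less_trans)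
  have "0 \<le> expectation (\<lambda>\<omega>. \<beta> (X \<omega>))"
    using \<beta>_nonneg by simp
  with le show "expectation (\<lambda>\<omega>. h (X \<omega>, Y \<omega>)) \<le> expectation (\<lambda>\<omega>. \<beta> (X \<omega>))"
    using int nonneg by (subst (asm) nn_integral_eq_integral) auto
qed

section \<open>Weighted averages and the step size condition\<close>

text \<open>A minimum never exceeds an average with positive weights; the hypothesis bounds the
  unnormalised average.\<close>

lemma Min_le_weighted_average:
  fixes e a :: "nat \<Rightarrow> real"
  assumes "K \<ge> 1" and a: "\<And>k. k \<in> {1..K} \<Longrightarrow> a k > 0"
    and le: "(\<Sum>k=1..K. a k * e k) \<le> D + B * (\<Sum>k=1..K. a k ^ 2)"
  shows "Min (e ` {1..K}) \<le> D / (\<Sum>k=1..K. a k) + B * ((\<Sum>k=1..K. a k ^ 2) / (\<Sum>k=1..K. a k))"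
proof -
  have pos: "(\<Sum>k=1..K. a k) > 0"
    using assms(1) a by (intro sum_pos) auto
  have "Min (e ` {1..K}) * (\<Sum>k=1..K. a k) = (\<Sum>k=1..K. a k * Min (e ` {1..K}))"
    by (subst mult.commute) (simp add: sum_distrib_right)
  also have "\<dots> \<le> (\<Sum>k=1..K. a k * e k)"
    using a by (intro sum_mono mult_left_mono) (auto intro: less_imp_le)
  finally show ?thesis
    using le pos by (simp add: field_simps)
qed

text \<open>Both quotients have a convergent numerator over a denominator that tends to
  infinity.\<close>

lemma weighted_average_bound_tendsto_0:
  fixes a :: "nat \<Rightarrow> real"
  assumes sq: "summable (\<lambda>k. a (k + 1) ^ 2)"
    and div: "filterlim (\<lambda>K. \<Sum>k=1..K. a k) at_top sequentially"
  shows "(\<lambda>K. D / (\<Sum>k=1..K. a k) + B * ((\<Sum>k=1..K. a k ^ 2) / (\<Sum>k=1..K. a k))) \<longlonglongrightarrow> 0"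
proof -
  have "(\<lambda>K. \<Sum>k<K. a (k + 1) ^ 2) \<longlonglongrightarrow> (\<Sum>k. a (k + 1) ^ 2)"
    using sq by (rule summable_LIMSEQ)
  \<comment> \<open>Series start at index 0 and step sizes at index 1, hence the shift.\<close>
  moreover have "(\<Sum>k<K. a (k + 1) ^ 2) = (\<Sum>k=1..K. a k ^ 2)" for K
    by (rule sum.reindex_bij_witness[of _ "\<lambda>k. k - 1" "\<lambda>k. k + 1"]) auto
  ultimately have s: "(\<lambda>K. \<Sum>k=1..K. a k ^ 2) \<longlonglongrightarrow> (\<Sum>k. a (k + 1) ^ 2)"
    by simp
  have inf: "filterlim (\<lambda>K. \<Sum>k=1..K. a k) at_infinity sequentially"
    using div by (rule filterlim_at_top_imp_at_infinity)
  show ?thesis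
    using tendsto_add[OF tendsto_divide_0[OF tendsto_const[of D] inf]
        tendsto_mult[OF tendsto_const[of B] tendsto_divide_0[OF s inf]]] by simp
qed


section \<open>Expected decrease of the objective in one step\<close>

text \<open>The gradient vanishes at the minimiser, so the descent inequality centred there traps
  \<open>h v - h\<close> at the minimiser between 0 and \<open>L / 2\<close> times the squared
  distance.\<close>

lemma (in prob_space) quadratic_growth_integrable:
  fixes h :: "'v::euclidean_space \<Rightarrow> real" and W :: "'a \<Rightarrow> 'v"
  assumes diff: "\<And>x. h differentiable (at x)"
    and lip: "\<And>u v. norm (grad h u - grad h v) \<le> L * norm (u - v)"
    and min: "is_arg_min h (\<lambda>_. True) x\<^sub>0"
    and [measurable]: "random_variable borel W"
    and sq: "integrable M (\<lambda>\<omega>. norm (W \<omega> - x\<^sub>0) ^ 2)"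
  shows "integrable M (\<lambda>\<omega>. h (W \<omega>))"
proof -
  have [measurable]: "h \<in> borel_measurable borel"
    using diff by (intro borel_measurable_continuous_onI)
      (simp add: continuous_on_eq_continuous_at differentiable_imp_continuous_within)
  have up: "h v - h x\<^sub>0 \<le> L / 2 * norm (v - x\<^sub>0) ^ 2" for v
    using descent_lemma[OF diff lip, of x\<^sub>0 "v - x\<^sub>0"] grad_argmin_eq_0[OF diff min] by simp
  have low: "0 \<le> h v - h x\<^sub>0" for v
    using min by (simp add: is_arg_min_linorder)
  have "integrable M (\<lambda>\<omega>. L / 2 * norm (W \<omega> - x\<^sub>0) ^ 2)"
    using sq by simp
  then have "integrable M (\<lambda>\<omega>. h (W \<omega>) - h x\<^sub>0)"
  proof (rule Bochner_Integration.integrable_bound)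
    show "AE \<omega> in M. norm (h (W \<omega>) - h x\<^sub>0) \<le> norm (L / 2 * norm (W \<omega> - x\<^sub>0) ^ 2)"
      using low up by (auto simp del: times_divide_eq_left intro: order_trans[OF _ abs_ge_self])
  qed measurable
  then have "integrable M (\<lambda>\<omega>. (h (W \<omega>) - h x\<^sub>0) + h x\<^sub>0)"
    by (rule Bochner_Integration.integrable_add) simp
  then show ?thesis
    by simp
qed

text \<open>The pair \<open>(a, b)\<close> abstracts the noise model, so bounded variance and
  interpolation share one proof. The third moment bound is written \<open>t ^ 3\<close> to keep the
  algebra polynomial.\<close>

lemma (in prob_space) expected_descent_step:
  fixes F :: "'v::euclidean_space \<Rightarrow> real" and W W' :: "'a \<Rightarrow> 'v" and Z :: "'a \<Rightarrow> 's"
    and g :: "'v \<Rightarrow> 's \<Rightarrow> 'v" and G H :: "'v \<Rightarrow> 'v"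
  assumes diff: "\<And>x. F differentiable (at x)"
    and lip: "\<And>u v. norm (grad F u - grad F v) \<le> L * norm (u - v)"
    and min: "is_arg_min F (\<lambda>_. True) x\<^sub>0"
    and W[measurable]: "random_variable borel W" and Z[measurable]: "random_variable S Z"
    and law: "distr M (borel \<Otimes>\<^sub>M S) (\<lambda>\<omega>. (W \<omega>, Z \<omega>)) = distr M borel W \<Otimes>\<^sub>M distr M S Z"
    and g[measurable]: "(\<lambda>(v, s). g v s) \<in> borel_measurable (borel \<Otimes>\<^sub>M S)"
    and g_int: "\<And>v. integrable M (\<lambda>\<omega>. g v (Z \<omega>))"
    and g_mean: "\<And>v. expectation (\<lambda>\<omega>. g v (Z \<omega>)) = grad F v"
    and g_sq: "\<And>v. integrable M (\<lambda>\<omega>. norm (g v (Z \<omega>)) ^ 2)"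
    and g_sq_le: "\<And>v. expectation (\<lambda>\<omega>. norm (g v (Z \<omega>)) ^ 2) \<le> a * norm (v - x\<^sub>0) ^ 2 + b"
    and ab: "a \<ge> 0" "b \<ge> 0" and pos: "L > 0" "c\<^sub>h \<ge> 0" "\<eta> > 0" "t > 0"
    and cube: "integrable M (\<lambda>\<omega>. norm (W \<omega> - x\<^sub>0) ^ 3)"
    and cube_le: "expectation (\<lambda>\<omega>. norm (W \<omega> - x\<^sub>0) ^ 3) \<le> t ^ 3"
    and GH: "\<And>x. G x = x - \<eta> *\<^sub>R H x"
    and G: "\<And>x. norm (G x) \<le> c\<^sub>g * norm x"
    and H: "\<And>x. norm (H x) \<le> c\<^sub>h * norm x ^ 2"
    and step: "\<And>\<omega>. \<omega> \<in> space M \<Longrightarrow> W' \<omega> = W \<omega> - \<eta> *\<^sub>R G (g (W \<omega>) (Z \<omega>))"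
    and W'_int: "integrable M (\<lambda>\<omega>. F (W' \<omega>))"
  shows "integrable M (\<lambda>\<omega>. norm (grad F (W \<omega>)) ^ 2)"
    and "\<eta> * expectation (\<lambda>\<omega>. norm (grad F (W \<omega>)) ^ 2) \<le>
      expectation (\<lambda>\<omega>. F (W \<omega>)) - expectation (\<lambda>\<omega>. F (W' \<omega>))
      + (c\<^sub>h * L * (a * t ^ 3 + b * t) + L / 2 * c\<^sub>g ^ 2 * (a * t ^ 2 + b)) * \<eta> ^ 2"
proof -
  define X where "X \<omega> = norm (W \<omega> - x\<^sub>0)" for \<omega>
  define n where "n \<omega> = norm (g (W \<omega>) (Z \<omega>))" for \<omega>
  define p where "p \<omega> = grad F (W \<omega>) \<bullet> g (W \<omega>) (Z \<omega>)" for \<omega>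
  have nonneg: "0 \<le> X \<omega>" "0 \<le> n \<omega>" for \<omega>
    by (simp_all add: X_def n_def)
  have X[measurable]: "X \<in> borel_measurable M"
    unfolding X_def by measurable
  have cube': "integrable M (\<lambda>\<omega>. X \<omega> ^ 3)" "expectation (\<lambda>\<omega>. X \<omega> ^ 3) \<le> t ^ 3"
    using cube cube_le by (simp_all add: X_def)
  note mom = moment_bounds_from_cube[OF X nonneg(1) cube' \<open>t > 0\<close>]
  have "L-lipschitz_on UNIV (grad F)"
    using lip \<open>L > 0\<close> by (intro lipschitz_onI) (auto simp: dist_norm)
  then have gradF[measurable]: "grad F \<in> borel_measurable borel"
    by (intro borel_measurable_continuous_onI lipschitz_on_continuous_on)
  have gW[measurable]: "(\<lambda>\<omega>. g (W \<omega>) (Z \<omega>)) \<in> borel_measurable M"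
    using measurable_compose[OF measurable_Pair[OF W Z] g] by simp
  have g'[measurable]: "(\<lambda>q. g (fst q) (snd q)) \<in> borel_measurable (borel \<Otimes>\<^sub>M S)"
    using g by (simp add: case_prod_beta)
  have gradF_le: "norm (grad F v) \<le> L * norm (v - x\<^sub>0)" for v
    using lip[of v x\<^sub>0] grad_argmin_eq_0[OF diff min] by simp
  have F_int: "integrable M (\<lambda>\<omega>. F (W \<omega>))"
    using mom(3) by (intro quadratic_growth_integrable[OF diff lip min W]) (simp add: X_def)

  have "integrable M (\<lambda>\<omega>. L ^ 2 * X \<omega> ^ 2)"
    using mom(3) by simp
  then show gradF_int: "integrable M (\<lambda>\<omega>. norm (grad F (W \<omega>)) ^ 2)"
  proof (rule Bochner_Integration.integrable_bound)
    show "AE \<omega> in M. norm (norm (grad F (W \<omega>)) ^ 2) \<le> norm (L ^ 2 * X \<omega> ^ 2)"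
      using power_mono[OF gradF_le norm_ge_zero, of _ 2] by (simp add: X_def power_mult_distrib)
  qed measurable

  have \<beta>1: "integrable M (\<lambda>\<omega>. a * norm (W \<omega> - x\<^sub>0) ^ 2 + b)"
    using mom(3) by (simp add: X_def)
  have n_sq: "integrable M (\<lambda>\<omega>. n \<omega> ^ 2)"
    and n_sq': "expectation (\<lambda>\<omega>. n \<omega> ^ 2) \<le> expectation (\<lambda>\<omega>. a * norm (W \<omega> - x\<^sub>0) ^ 2 + b)"
    using product_law_integral_le[OF W Z law, of "\<lambda>q. norm (g (fst q) (snd q)) ^ 2", OF _ _ _ _ \<beta>1] g_sq g_sq_le
    by (auto simp: n_def)
  have n_sq_le: "expectation (\<lambda>\<omega>. n \<omega> ^ 2) \<le> a * t ^ 2 + b"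
  proof -
    have "expectation (\<lambda>\<omega>. a * norm (W \<omega> - x\<^sub>0) ^ 2 + b) = a * expectation (\<lambda>\<omega>. X \<omega> ^ 2) + b"
      using mom(3) by (simp add: X_def prob_space)
    with n_sq' mult_left_mono[OF mom(4) ab(1)] show ?thesis
      by simp
  qed

  have \<beta>2: "integrable M (\<lambda>\<omega>. a * norm (W \<omega> - x\<^sub>0) ^ 3 + b * norm (W \<omega> - x\<^sub>0))"
    using mom(1) cube by (simp add: X_def)
  \<comment> \<open>The distance factor is constant once \<open>v\<close> is frozen. Multiplying the
    second moment bound by it raises the powers to 3 and 1; this is where the third moment of the
    iterate is consumed.\<close>
  have sect: "norm (v - x\<^sub>0) * expectation (\<lambda>\<omega>. norm (g v (Z \<omega>)) ^ 2)
      \<le> a * norm (v - x\<^sub>0) ^ 3 + b * norm (v - x\<^sub>0)" for v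
    using mult_left_mono[OF g_sq_le[of v], of "norm (v - x\<^sub>0)"]
    by (simp add: algebra_simps power2_eq_square power3_eq_cube)
  have Xn: "integrable M (\<lambda>\<omega>. X \<omega> * n \<omega> ^ 2)"
    and Xn': "expectation (\<lambda>\<omega>. X \<omega> * n \<omega> ^ 2)
      \<le> expectation (\<lambda>\<omega>. a * norm (W \<omega> - x\<^sub>0) ^ 3 + b * norm (W \<omega> - x\<^sub>0))"
    using product_law_integral_le[OF W Z law,
        of "\<lambda>q. norm (fst q - x\<^sub>0) * norm (g (fst q) (snd q)) ^ 2", OF _ _ _ _ \<beta>2] g_sq sect
    by (auto simp: n_def X_def)
  have Xn_le: "expectation (\<lambda>\<omega>. X \<omega> * n \<omega> ^ 2) \<le> a * t ^ 3 + b * t"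
  proof -
    have "expectation (\<lambda>\<omega>. a * norm (W \<omega> - x\<^sub>0) ^ 3 + b * norm (W \<omega> - x\<^sub>0))
        = a * expectation (\<lambda>\<omega>. X \<omega> ^ 3) + b * expectation X"
      using mom(1) cube by (simp add: X_def[abs_def])
    with Xn' mult_left_mono[OF cube'(2) ab(1)] mult_left_mono[OF mom(2) ab(2)] show ?thesis
      by simp
  qed

  \<comment> \<open>Fubini for the linear term needs its integrability first. The product of
    distance and gradient norm is split into squares, each already known to be integrable.\<close>
  have "integrable M (\<lambda>\<omega>. L * (X \<omega> ^ 2 + n \<omega> ^ 2))"
    using mom(3) n_sq by simp
  then have p_int: "integrable M p"
  proof (rule Bochner_Integration.integrable_bound)
    show "p \<in> borel_measurable M"
      unfolding p_def by measurable
    have "\<bar>p \<omega>\<bar> \<le> L * (X \<omega> ^ 2 + n \<omega> ^ 2)" for \<omega>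
    proof -
      have "\<bar>p \<omega>\<bar> \<le> norm (grad F (W \<omega>)) * n \<omega>"
        unfolding p_def n_def by (rule Cauchy_Schwarz_ineq2)
      also have "\<dots> \<le> L * X \<omega> * n \<omega>"
        using gradF_le by (intro mult_right_mono nonneg) (simp add: X_def)
      also have "\<dots> \<le> L * (X \<omega> ^ 2 + n \<omega> ^ 2)"
      proof -
        have "X \<omega> * n \<omega> \<le> X \<omega> ^ 2 + n \<omega> ^ 2"
          using sum_squares_bound[of "X \<omega>" "n \<omega>"]
            mult_nonneg_nonneg[OF nonneg(1)[of \<omega>] nonneg(2)[of \<omega>]] by linarith
        then show ?thesis
          using \<open>L > 0\<close> by (simp add: mult.assoc)
      qed
      finally show ?thesis .
    qed
    then show "AE \<omega> in M. norm (p \<omega>) \<le> norm (L * (X \<omega> ^ 2 + n \<omega> ^ 2))"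
      by (auto intro: order_trans[OF _ abs_ge_self])
  qed
  have p_mean: "expectation p = expectation (\<lambda>\<omega>. norm (grad F (W \<omega>)) ^ 2)"
  proof -
    have "expectation p
        = (\<integral>\<omega>. (\<integral>\<omega>'. grad F (W \<omega>) \<bullet> g (W \<omega>) (Z \<omega>') \<partial>M) \<partial>M)"
      using product_law_integral[OF W Z law, of "\<lambda>q. grad F (fst q) \<bullet> g (fst q) (snd q)"] p_int
      by (simp add: p_def[abs_def])
    also have "\<dots> = expectation (\<lambda>\<omega>. norm (grad F (W \<omega>)) ^ 2)"
      using g_int g_mean by (simp add: power2_norm_eq_inner)
    finally show ?thesis .
  qed

  \<comment> \<open>In the first-order term \<open>G\<close> is split as
    \<open>x - \<eta> *\<^sub>R H x\<close>: the part \<open>x\<close> yields \<open>p\<close>,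
    whose mean is known exactly, and the \<open>H\<close> part is of order
    \<open>\<eta> ^ 2\<close>. The quadratic term is already of that order, so there the growth
    bound on \<open>G\<close> suffices.\<close>
  have pointwise: "F (W' \<omega>) \<le> F (W \<omega>) - \<eta> * p \<omega>
      + c\<^sub>h * L * \<eta> ^ 2 * (X \<omega> * n \<omega> ^ 2) + L / 2 * c\<^sub>g ^ 2 * \<eta> ^ 2 * n \<omega> ^ 2"
    if \<omega>: "\<omega> \<in> space M" for \<omega>
  proof -
    let ?x = "g (W \<omega>) (Z \<omega>)" and ?D = "grad F (W \<omega>)"
    let ?d = "- (\<eta> *\<^sub>R G ?x)"
    have "F (W' \<omega>) \<le> F (W \<omega>) + ?d \<bullet> ?D + L / 2 * norm ?d ^ 2"
      using descent_lemma[OF diff lip, of "W \<omega>" ?d] step[OF \<omega>] by simp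
    moreover have "?d \<bullet> ?D \<le> - \<eta> * p \<omega> + c\<^sub>h * L * \<eta> ^ 2 * (X \<omega> * n \<omega> ^ 2)"
    proof -
      have "H ?x \<bullet> ?D \<le> norm (H ?x) * norm ?D"
        by (rule norm_cauchy_schwarz)
      also have "\<dots> \<le> (c\<^sub>h * n \<omega> ^ 2) * (L * X \<omega>)"
        using H[of ?x] gradF_le[of "W \<omega>"] \<open>c\<^sub>h \<ge> 0\<close> by (intro mult_mono) (auto simp: n_def X_def)
      finally have "\<eta> ^ 2 * (H ?x \<bullet> ?D) \<le> \<eta> ^ 2 * ((c\<^sub>h * n \<omega> ^ 2) * (L * X \<omega>))"
        by (intro mult_left_mono) auto
      moreover have "?d \<bullet> ?D = - \<eta> * p \<omega> + \<eta> ^ 2 * (H ?x \<bullet> ?D)"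
        by (simp add: GH p_def inner_diff_left inner_commute[of ?D] power2_eq_square algebra_simps)
      ultimately show ?thesis
        by (simp add: mult_ac)
    qed
    moreover have "L / 2 * norm ?d ^ 2 \<le> L / 2 * c\<^sub>g ^ 2 * \<eta> ^ 2 * n \<omega> ^ 2"
    proof -
      have "norm ?d ^ 2 \<le> (\<eta> * (c\<^sub>g * n \<omega>)) ^ 2"
        using G[of ?x] \<open>\<eta> > 0\<close> by (intro power_mono) (auto simp: n_def)
      then have "L / 2 * norm ?d ^ 2 \<le> L / 2 * (\<eta> * (c\<^sub>g * n \<omega>)) ^ 2"
        using \<open>L > 0\<close> by (intro mult_left_mono) auto
      then show ?thesis
        by (simp add: power_mult_distrib mult_ac)
    qed
    ultimately show ?thesis by simp
  qed
  have "expectation (\<lambda>\<omega>. F (W' \<omega>)) \<le> expectation (\<lambda>\<omega>. F (W \<omega>) - \<eta> * p \<omega>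
      + c\<^sub>h * L * \<eta> ^ 2 * (X \<omega> * n \<omega> ^ 2) + L / 2 * c\<^sub>g ^ 2 * \<eta> ^ 2 * n \<omega> ^ 2)"
    using F_int p_int Xn n_sq by (intro integral_mono W'_int pointwise) auto
  also have "\<dots> = expectation (\<lambda>\<omega>. F (W \<omega>)) - \<eta> * expectation p
      + c\<^sub>h * L * \<eta> ^ 2 * expectation (\<lambda>\<omega>. X \<omega> * n \<omega> ^ 2)
      + L / 2 * c\<^sub>g ^ 2 * \<eta> ^ 2 * expectation (\<lambda>\<omega>. n \<omega> ^ 2)"
    using F_int p_int Xn n_sq by simp
  also have "\<dots> \<le> expectation (\<lambda>\<omega>. F (W \<omega>)) - \<eta> * expectation p
      + c\<^sub>h * L * \<eta> ^ 2 * (a * t ^ 3 + b * t) + L / 2 * c\<^sub>g ^ 2 * \<eta> ^ 2 * (a * t ^ 2 + b)"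
    using pos by (intro add_mono mult_left_mono order_refl Xn_le n_sq_le) auto
  finally show "\<eta> * expectation (\<lambda>\<omega>. norm (grad F (W \<omega>)) ^ 2) \<le>
      expectation (\<lambda>\<omega>. F (W \<omega>)) - expectation (\<lambda>\<omega>. F (W' \<omega>))
      + (c\<^sub>h * L * (a * t ^ 3 + b * t) + L / 2 * c\<^sub>g ^ 2 * (a * t ^ 2 + b)) * \<eta> ^ 2"
    unfolding p_mean by (simp add: algebra_simps)
qed

section \<open>Independence of the iterate and the current sample\<close>

text \<open>Induction on \<open>k\<close>: the first iterate is constant, a function of the empty
  tuple, and each step reads one further sample. An explicit function \<open>\<Phi>\<close> of the
  past tuple lets independence of index blocks be used directly.\<close>

lemma iterates_measurable_in_past:
  fixes x :: "nat \<Rightarrow> 'a \<Rightarrow> 'v" and z :: "nat \<Rightarrow> 'a \<Rightarrow> 's"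
  assumes init: "\<And>\<omega>. \<omega> \<in> \<Omega> \<Longrightarrow> x 1 \<omega> = x\<^sub>1" and x\<^sub>1: "x\<^sub>1 \<in> space N"
    and step: "\<And>k \<omega>. k \<ge> 1 \<Longrightarrow> \<omega> \<in> \<Omega> \<Longrightarrow> x (k + 1) \<omega> = u k (x k \<omega>, z k \<omega>)"
    and u: "\<And>k. k \<ge> 1 \<Longrightarrow> u k \<in> measurable (N \<Otimes>\<^sub>M S) N"
    and "k \<ge> 1"
  shows "\<exists>\<Phi>. \<Phi> \<in> measurable (PiM {1..<k} (\<lambda>_. S)) N
    \<and> (\<forall>\<omega>\<in>\<Omega>. x k \<omega> = \<Phi> (restrict (\<lambda>i. z i \<omega>) {1..<k}))"
  using \<open>k \<ge> 1\<close>
proof (induction k rule: nat_induct_at_least)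
  case base
  show ?case
    using init x\<^sub>1 by (intro exI[of _ "\<lambda>_. x\<^sub>1"]) auto
next
  case (Suc k)
  from Suc.IH obtain \<Phi> where \<Phi>: "\<Phi> \<in> measurable (PiM {1..<k} (\<lambda>_. S)) N"
    and eq: "\<And>\<omega>. \<omega> \<in> \<Omega> \<Longrightarrow> x k \<omega> = \<Phi> (restrict (\<lambda>i. z i \<omega>) {1..<k})"
    by blast
  \<comment> \<open>The new function forgets coordinate \<open>k\<close> before applying the old
    one, and then reads coordinate \<open>k\<close> as the fresh sample.\<close>
  have "(\<lambda>y. \<Phi> (restrict y {1..<k})) \<in> measurable (PiM {1..<Suc k} (\<lambda>_. S)) N"
    by (rule measurable_compose[OF measurable_restrict_subset \<Phi>]) auto
  moreover have "(\<lambda>y. y k) \<in> measurable (PiM {1..<Suc k} (\<lambda>_. S)) S"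
    using Suc.hyps by (intro measurable_component_singleton) auto
  ultimately have "(\<lambda>y. u k (\<Phi> (restrict y {1..<k}), y k)) \<in> measurable (PiM {1..<Suc k} (\<lambda>_. S)) N"
    by (intro measurable_compose[OF measurable_Pair u[OF Suc.hyps]])
  moreover have "x (Suc k) \<omega> = u k (\<Phi> (restrict (restrict (\<lambda>i. z i \<omega>) {1..<Suc k}) {1..<k}),
      restrict (\<lambda>i. z i \<omega>) {1..<Suc k} k)" if "\<omega> \<in> \<Omega>" for \<omega>
  proof -
    have "{1..<Suc k} \<inter> {1..<k} = {1..<k}"
      by auto
    then show ?thesis
      using step[OF Suc.hyps that] eq[OF that] Suc.hyps by simp
  qed
  ultimately show ?case
    by (intro exI[of _ "\<lambda>y. u k (\<Phi> (restrict y {1..<k}), y k)"] conjI ballI)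
qed

text \<open>The index blocks \<open>{1..<k}\<close> and \<open>{k}\<close> are disjoint, so the
  corresponding tuples are independent; \<open>\<Phi>\<close> and the projection to coordinate
  \<open>k\<close> carry this over to the iterate and the sample.\<close>

lemma (in prob_space) iterate_law_product:
  fixes x :: "nat \<Rightarrow> 'a \<Rightarrow> 'v" and z :: "nat \<Rightarrow> 'a \<Rightarrow> 's"
  assumes indep: "indep_vars (\<lambda>_. S) z {1..}"
    and init: "\<And>\<omega>. \<omega> \<in> space M \<Longrightarrow> x 1 \<omega> = x\<^sub>1" and x\<^sub>1: "x\<^sub>1 \<in> space N"
    and step: "\<And>k \<omega>. k \<ge> 1 \<Longrightarrow> \<omega> \<in> space M \<Longrightarrow> x (k + 1) \<omega> = u k (x k \<omega>, z k \<omega>)"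
    and u: "\<And>k. k \<ge> 1 \<Longrightarrow> u k \<in> measurable (N \<Otimes>\<^sub>M S) N"
    and k: "k \<ge> 1"
  shows "random_variable N (x k)"
    and "distr M (N \<Otimes>\<^sub>M S) (\<lambda>\<omega>. (x k \<omega>, z k \<omega>)) = distr M N (x k) \<Otimes>\<^sub>M distr M S (z k)"
proof -
  obtain \<Phi> where \<Phi>: "\<Phi> \<in> measurable (PiM {1..<k} (\<lambda>_. S)) N"
    and eq: "\<And>\<omega>. \<omega> \<in> space M \<Longrightarrow> x k \<omega> = \<Phi> (restrict (\<lambda>i. z i \<omega>) {1..<k})"
    using iterates_measurable_in_past[where x = x and z = z and u = u and \<Omega> = "space M", OF init x\<^sub>1 step u k]
    by blast
  let ?X = "\<lambda>\<omega>. restrict (\<lambda>i. z i \<omega>) {1..<k}" and ?Z = "\<lambda>\<omega>. restrict (\<lambda>i. z i \<omega>) {k}"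
  have iv: "indep_var (PiM {1..<k} (\<lambda>_. S)) ?X (PiM {k} (\<lambda>_. S)) ?Z"
    using indep k by (intro indep_var_restrict) auto
  have "(\<lambda>\<omega>. \<Phi> (?X \<omega>)) \<in> measurable M N"
    by (rule measurable_compose[OF indep_var_rv1[OF iv] \<Phi>])
  then show "random_variable N (x k)"
    using eq by (simp cong: measurable_cong)
  have "(\<lambda>y. y k) \<in> measurable (PiM {k} (\<lambda>_. S)) S"
    by (rule measurable_component_singleton) simp
  from joint_law_compose[OF iv \<Phi> this]
  have "distr M (N \<Otimes>\<^sub>M S) (\<lambda>\<omega>. (\<Phi> (?X \<omega>), z k \<omega>)) = distr M N (\<lambda>\<omega>. \<Phi> (?X \<omega>)) \<Otimes>\<^sub>M distr M S (z k)"
    by simp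
  moreover have "distr M (N \<Otimes>\<^sub>M S) (\<lambda>\<omega>. (\<Phi> (?X \<omega>), z k \<omega>)) = distr M (N \<Otimes>\<^sub>M S) (\<lambda>\<omega>. (x k \<omega>, z k \<omega>))"
    by (rule distr_cong) (simp_all add: eq)
  moreover have "distr M N (\<lambda>\<omega>. \<Phi> (?X \<omega>)) = distr M N (x k)"
    by (rule distr_cong) (simp_all add: eq)
  ultimately show "distr M (N \<Otimes>\<^sub>M S) (\<lambda>\<omega>. (x k \<omega>, z k \<omega>)) = distr M N (x k) \<Otimes>\<^sub>M distr M S (z k)"
    by simp
qed

section \<open>Both noise models, transfer to the samples, and telescoping\<close>

theorem theorem4:
  fixes P :: "'a measure" and S :: "'s measure"
    and \<xi>s :: "nat \<Rightarrow> 'a \<Rightarrow> 's" and \<xi> :: "'a \<Rightarrow> 's"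
    and f :: "real ^ 'd \<Rightarrow> 's \<Rightarrow> real" and F :: "real ^ 'd \<Rightarrow> real"
    and G H :: "real ^ 'd \<Rightarrow> real \<Rightarrow> real ^ 'd"
    and \<alpha> :: "nat \<Rightarrow> real" and w :: "nat \<Rightarrow> 'a \<Rightarrow> real ^ 'd" and w\<^sub>1 wstar :: "real ^ 'd"
    and L\<^sub>\<xi> :: "'a \<Rightarrow> real" and c\<^sub>g c\<^sub>h L \<sigma> M :: real and i :: nat
  assumes prob: "prob_space P" and complete: "complete_measure P"
    and xis_indep: "prob_space.indep_vars P (\<lambda>_. S) \<xi>s {1..}"
    and xi_measurable: "\<xi> \<in> measurable P S"
    and xis_distr: "\<And>k. k \<ge> 1 \<Longrightarrow> distr P S (\<xi>s k) = distr P S \<xi>"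
    and f_measurable: "\<And>v. f v \<in> borel_measurable S"
    and f_differentiable: "\<And>v s. s \<in> space S \<Longrightarrow> (\<lambda>u. f u s) differentiable (at v)"
    and f_integrable: "\<And>v. integrable P (\<lambda>\<omega>. f v (\<xi> \<omega>))"
    and F_eq: "\<And>v. F v = (\<integral>\<omega>. f v (\<xi> \<omega>) \<partial>P)"
    and GH: "\<And>x a. a > 0 \<Longrightarrow> G x a = x - a *\<^sub>R H x a"
    and G_measurable: "\<And>a. a > 0 \<Longrightarrow> (\<lambda>x. G x a) \<in> borel_measurable borel"
    and step_pos: "\<And>k. k \<ge> 1 \<Longrightarrow> \<alpha> k > 0"
    and w_init: "\<And>\<omega>. \<omega> \<in> space P \<Longrightarrow> w 1 \<omega> = w\<^sub>1"
    and w_step: "\<And>k \<omega>. k \<ge> 1 \<Longrightarrow> \<omega> \<in> space P \<Longrightarrow>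
      w (k + 1) \<omega> = w k \<omega> - \<alpha> k *\<^sub>R G (grad (\<lambda>u. f u (\<xi>s k \<omega>)) (w k \<omega>)) (\<alpha> k)"
    and A1_const: "c\<^sub>g > 0" "c\<^sub>h \<ge> 0"
    and A1_G: "\<And>x a. a > 0 \<Longrightarrow> norm (G x a) \<le> c\<^sub>g * norm x"
    and A1_H: "\<And>x a. a > 0 \<Longrightarrow> norm (H x a) \<le> c\<^sub>h * norm x ^ 2"
    and A2_integrable: "\<And>v. integrable P (\<lambda>\<omega>. grad (\<lambda>u. f u (\<xi> \<omega>)) v)"
    and A2: "\<And>v. (\<integral>\<omega>. grad (\<lambda>u. f u (\<xi> \<omega>)) v \<partial>P) = grad F v"
    and A3_C1: "C1_everywhere F"
    and A3_L: "L > 0"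
    and A3_F: "\<And>u v. norm (grad F u - grad F v) \<le> L * norm (u - v)"
    and A3_L\<xi>_measurable: "L\<^sub>\<xi> \<in> borel_measurable (vimage_algebra (space P) \<xi> S)"
    and A3_L\<xi>_pos: "\<And>\<omega>. \<omega> \<in> space P \<Longrightarrow> L\<^sub>\<xi> \<omega> > 0"
    and A3_L\<xi>_sq_integrable: "integrable P (\<lambda>\<omega>. L\<^sub>\<xi> \<omega> ^ 2)"
    and A3_f: "AE \<omega> in P. \<forall>u v.
      norm (grad (\<lambda>x. f x (\<xi> \<omega>)) u - grad (\<lambda>x. f x (\<xi> \<omega>)) v) \<le> L\<^sub>\<xi> \<omega> * norm (u - v)"
    and A3_L\<xi>_bound: "(\<integral>\<omega>. L\<^sub>\<xi> \<omega> ^ 2 \<partial>P) \<le> L^2"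
    and i_cases: "i \<in> {1, 2}"
    and wstar_argmin: "is_arg_min F (\<lambda>_. True) wstar"
    and A4: "i = 1 \<Longrightarrow> integrable P (\<lambda>\<omega>. norm (grad (\<lambda>u. f u (\<xi> \<omega>)) wstar) ^ 2)
      \<and> (\<integral>\<omega>. norm (grad (\<lambda>u. f u (\<xi> \<omega>)) wstar) ^ 2 \<partial>P) \<le> \<sigma>^2"
    and A5: "i = 2 \<Longrightarrow> AE \<omega> in P. is_arg_min (\<lambda>u. f u (\<xi> \<omega>)) (\<lambda>_. True) wstar"
    and A6_M: "M > 0"
    and A6: "\<And>k. k \<ge> 1 \<Longrightarrow> integrable P (\<lambda>\<omega>. norm (w k \<omega> - wstar) ^ 3)
      \<and> (\<integral>\<omega>. norm (w k \<omega> - wstar) ^ 3 \<partial>P) \<le> M"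
  shows "(\<forall>k\<ge>1. integrable P (\<lambda>\<omega>. norm (grad F (w k \<omega>)) ^ 2))
    \<and> (\<forall>K\<ge>1. Min ((\<lambda>k. \<integral>\<omega>. norm (grad F (w k \<omega>)) ^ 2 \<partial>P) ` {1..K})
         \<le> (F w\<^sub>1 - F wstar) / (\<Sum>k=1..K. \<alpha> k)
           + (if i = 1 then B1 c\<^sub>g c\<^sub>h L M \<sigma> else B2 c\<^sub>g c\<^sub>h L M)
             * ((\<Sum>k=1..K. \<alpha> k ^ 2) / (\<Sum>k=1..K. \<alpha> k)))
    \<and> (summable (\<lambda>k. \<alpha> (k + 1) ^ 2) \<and> filterlim (\<lambda>K. \<Sum>k=1..K. \<alpha> k) at_top sequentially
         \<longrightarrow> (\<lambda>K. Min ((\<lambda>k. \<integral>\<omega>. norm (grad F (w k \<omega>)) ^ 2 \<partial>P) ` {1..K})) \<longlonglongrightarrow> 0)"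
proof -
  interpret prob_space P by (rule prob)
  define g where "g v s = grad (\<lambda>u. f u s) v" for v s
  define t where "t = M powr (1/3)"
  \<comment> \<open>The factors 2 for \<open>i = 1\<close> come from squaring a sum of two norms.
    For \<open>i = 2\<close> the gradient at \<open>wstar\<close> vanishes almost surely, so there
    is only one norm and no constant term.\<close>
  define a where "a = (if i = 1 then 2 * L ^ 2 else L ^ 2)"
  define b where "b = (if i = 1 then 2 * \<sigma> ^ 2 else 0)"
  define B where "B = c\<^sub>h * L * (a * t ^ 3 + b * t) + L / 2 * c\<^sub>g ^ 2 * (a * t ^ 2 + b)"
  have t: "t > 0" "t ^ 3 = M" "t ^ 2 = M powr (2/3)"
    using A6_M by (simp_all add: t_def powr_power)
  have B_eq: "B = (if i = 1 then B1 c\<^sub>g c\<^sub>h L M \<sigma> else B2 c\<^sub>g c\<^sub>h L M)"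
    unfolding B_def B1_def B2_def a_def b_def t(2,3) t_def[symmetric]
    by (auto simp: algebra_simps power2_eq_square power3_eq_cube)
  have F_diff: "F differentiable (at x)" for x
    using A3_C1 by (simp add: C1_everywhere_def)
  have g: "(\<lambda>(v, s). g v s) \<in> borel_measurable (borel \<Otimes>\<^sub>M S)"
    unfolding g_def using f_differentiable f_measurable by (rule borel_measurable_grad)
  have gv[measurable]: "g v \<in> borel_measurable S" for v
    using measurable_compose[OF measurable_Pair1' g, of v] by simp
  note [measurable] = xi_measurable
  have xis[measurable]: "\<xi>s k \<in> measurable P S" if "k \<ge> 1" for k
    using xis_indep that by (auto simp: indep_vars_def)

  \<comment> \<open>The coefficient \<open>a / L ^ 2\<close> is 2 or 1, so one inequality serves
    both cases. It keeps the random \<open>L\<^sub>\<xi>\<close>, and its exceptional null set is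
    the same for all \<open>v\<close>.\<close>
  have g_wstar: "integrable P (\<lambda>\<omega>. norm (g wstar (\<xi> \<omega>)) ^ 2)"
    and g_sq_split: "AE \<omega> in P. \<forall>v. norm (g v (\<xi> \<omega>)) ^ 2
      \<le> (a / L ^ 2) * (L\<^sub>\<xi> \<omega> ^ 2 * norm (v - wstar) ^ 2) + (if i = 1 then 2 else 0) * norm (g wstar (\<xi> \<omega>)) ^ 2"
    and b_bound: "(if i = 1 then 2 else 0) * expectation (\<lambda>\<omega>. norm (g wstar (\<xi> \<omega>)) ^ 2) \<le> b"
  proof -
    show "(if i = 1 then 2 else 0) * expectation (\<lambda>\<omega>. norm (g wstar (\<xi> \<omega>)) ^ 2) \<le> b"
      using A4 by (auto simp: b_def g_def)
    have zero: "AE \<omega> in P. g wstar (\<xi> \<omega>) = 0" if "i = 2"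
      using A5[OF that] AE_space
    proof eventually_elim
      case (elim \<omega>)
      then show ?case
        unfolding g_def using measurable_space[OF xi_measurable]
        by (intro grad_argmin_eq_0 f_differentiable) auto
    qed
    show "integrable P (\<lambda>\<omega>. norm (g wstar (\<xi> \<omega>)) ^ 2)"
    proof (cases "i = 1")
      case True
      then show ?thesis using A4 by (simp add: g_def)
    next
      case False
      then have "AE \<omega> in P. g wstar (\<xi> \<omega>) = 0" using i_cases zero by auto
      then have "AE \<omega> in P. norm (g wstar (\<xi> \<omega>)) ^ 2 = 0" by eventually_elim simp
      then show ?thesis
        by (subst integrable_cong_AE[where g = "\<lambda>_. 0"]) auto
    qed
    have dist: "norm (g v (\<xi> \<omega>) - g wstar (\<xi> \<omega>)) ^ 2 \<le> L\<^sub>\<xi> \<omega> ^ 2 * norm (v - wstar) ^ 2"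
      if "\<forall>u v. norm (grad (\<lambda>x. f x (\<xi> \<omega>)) u - grad (\<lambda>x. f x (\<xi> \<omega>)) v) \<le> L\<^sub>\<xi> \<omega> * norm (u - v)" for \<omega> v
    proof -
      have "norm (g v (\<xi> \<omega>) - g wstar (\<xi> \<omega>)) ^ 2 \<le> (L\<^sub>\<xi> \<omega> * norm (v - wstar)) ^ 2"
        using that by (intro power_mono) (auto simp: g_def)
      then show ?thesis by (simp add: power_mult_distrib)
    qed
    show "AE \<omega> in P. \<forall>v. norm (g v (\<xi> \<omega>)) ^ 2
      \<le> (a / L ^ 2) * (L\<^sub>\<xi> \<omega> ^ 2 * norm (v - wstar) ^ 2) + (if i = 1 then 2 else 0) * norm (g wstar (\<xi> \<omega>)) ^ 2"
    proof (cases "i = 1")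
      case True
      show ?thesis
        using A3_f
      proof eventually_elim
        case (elim \<omega>)
        show ?case
        proof
          fix v
          let ?x = "g v (\<xi> \<omega>)" and ?y = "g wstar (\<xi> \<omega>)"
          have "norm ?x ^ 2 \<le> (norm (?x - ?y) + norm ?y) ^ 2"
            by (intro power_mono) (auto simp: norm_triangle_sub add.commute)
          also have "\<dots> \<le> 2 * norm (?x - ?y) ^ 2 + 2 * norm ?y ^ 2"
            using sum_squares_bound[of "norm (?x - ?y)" "norm ?y"] by (simp add: power2_sum)
          finally show "norm ?x ^ 2 \<le> (a / L ^ 2) * (L\<^sub>\<xi> \<omega> ^ 2 * norm (v - wstar) ^ 2)
              + (if i = 1 then 2 else 0) * norm ?y ^ 2"
            using dist[OF elim, of v] True A3_L by (simp add: a_def)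
        qed
      qed
    next
      case False
      then have "AE \<omega> in P. g wstar (\<xi> \<omega>) = 0" using i_cases zero by auto
      with A3_f show ?thesis
      proof eventually_elim
        case (elim \<omega>)
        then show ?case using dist[OF elim(1)] False A3_L by (simp add: a_def)
      qed
    qed
  qed
  have g_sq: "integrable P (\<lambda>\<omega>. norm (g v (\<xi> \<omega>)) ^ 2)"
    and g_sq_le: "expectation (\<lambda>\<omega>. norm (g v (\<xi> \<omega>)) ^ 2) \<le> a * norm (v - wstar) ^ 2 + b" for v
  proof -
    let ?r = "\<lambda>\<omega>. (a / L ^ 2) * (L\<^sub>\<xi> \<omega> ^ 2 * norm (v - wstar) ^ 2)
      + (if i = 1 then 2 else 0) * norm (g wstar (\<xi> \<omega>)) ^ 2"
    have r: "integrable P ?r"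
      by (intro Bochner_Integration.integrable_add integrable_mult_right integrable_mult_left
          A3_L\<xi>_sq_integrable g_wstar)
    have le: "AE \<omega> in P. norm (g v (\<xi> \<omega>)) ^ 2 \<le> ?r \<omega>"
      using g_sq_split by eventually_elim blast
    show int: "integrable P (\<lambda>\<omega>. norm (g v (\<xi> \<omega>)) ^ 2)"
    proof (rule Bochner_Integration.integrable_bound[OF r])
      show "AE \<omega> in P. norm (norm (g v (\<xi> \<omega>)) ^ 2) \<le> norm (?r \<omega>)"
        using le
      proof eventually_elim
        case (elim \<omega>)
        then show ?case
          unfolding real_norm_def by (intro order_trans[OF _ abs_ge_self]) simp
      qed
    qed measurable
    have "expectation (\<lambda>\<omega>. norm (g v (\<xi> \<omega>)) ^ 2) \<le> expectation ?r"
      using int r le by (rule integral_mono_AE)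
    also have "\<dots> = (a / L ^ 2) * (expectation (\<lambda>\<omega>. L\<^sub>\<xi> \<omega> ^ 2) * norm (v - wstar) ^ 2)
        + (if i = 1 then 2 else 0) * expectation (\<lambda>\<omega>. norm (g wstar (\<xi> \<omega>)) ^ 2)"
      using A3_L\<xi>_sq_integrable g_wstar by simp
    \<comment> \<open>The second moment of the random Lipschitz constant is replaced by
      \<open>L ^ 2\<close>, which cancels the denominator.\<close>
    also have "\<dots> \<le> (a / L ^ 2) * (L ^ 2 * norm (v - wstar) ^ 2) + b"
      using A3_L by (intro add_mono b_bound mult_left_mono mult_right_mono A3_L\<xi>_bound) (auto simp: a_def)
    also have "\<dots> = a * norm (v - wstar) ^ 2 + b"
      using A3_L by simp
    finally show "expectation (\<lambda>\<omega>. norm (g v (\<xi> \<omega>)) ^ 2) \<le> a * norm (v - wstar) ^ 2 + b" .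
  qed

  \<comment> \<open>The gradient assumptions concern \<open>\<xi>\<close>, whereas step
    \<open>k\<close> draws \<open>\<xi>s k\<close>; equality of laws carries them across.\<close>
  have transfer_integrable: "integrable P (\<lambda>\<omega>. \<phi> (\<xi>s k \<omega>)) \<longleftrightarrow> integrable P (\<lambda>\<omega>. \<phi> (\<xi> \<omega>))"
    and transfer_expectation: "expectation (\<lambda>\<omega>. \<phi> (\<xi>s k \<omega>)) = expectation (\<lambda>\<omega>. \<phi> (\<xi> \<omega>))"
    if "k \<ge> 1" "\<phi> \<in> borel_measurable S" for k and \<phi> :: "'s \<Rightarrow> 'b::{banach, second_countable_topology}"
    using that xis_distr[OF that(1)]
      integrable_distr_eq[OF xis[OF that(1)] that(2)] integrable_distr_eq[OF xi_measurable that(2)]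
      integral_distr[OF xis[OF that(1)] that(2)] integral_distr[OF xi_measurable that(2)]
    by simp_all

  have u: "(\<lambda>p. fst p - \<alpha> k *\<^sub>R G (g (fst p) (snd p)) (\<alpha> k)) \<in> measurable (borel \<Otimes>\<^sub>M S) borel"
    if "k \<ge> 1" for k
    using measurable_compose[OF g G_measurable[OF step_pos[OF that]]]
    by (intro borel_measurable_diff borel_measurable_scaleR) (auto simp: case_prod_beta)
  have w_step': "w (k + 1) \<omega> = fst (w k \<omega>, \<xi>s k \<omega>)
      - \<alpha> k *\<^sub>R G (g (fst (w k \<omega>, \<xi>s k \<omega>)) (snd (w k \<omega>, \<xi>s k \<omega>))) (\<alpha> k)"
    if "k \<ge> 1" "\<omega> \<in> space P" for k \<omega>
    using w_step[OF that] by (simp add: g_def)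
  have w_meas: "w k \<in> borel_measurable P"
    and law: "distr P (borel \<Otimes>\<^sub>M S) (\<lambda>\<omega>. (w k \<omega>, \<xi>s k \<omega>)) = distr P borel (w k) \<Otimes>\<^sub>M distr P S (\<xi>s k)"
    if "k \<ge> 1" for k
    using iterate_law_product[where N = borel and x = w and z = \<xi>s
        and u = "\<lambda>k p. fst p - \<alpha> k *\<^sub>R G (g (fst p) (snd p)) (\<alpha> k)",
        OF xis_indep w_init _ w_step' u that] by simp_all

  define e where "e k = expectation (\<lambda>\<omega>. norm (grad F (w k \<omega>)) ^ 2)" for k
  have Fw_int: "integrable P (\<lambda>\<omega>. F (w k \<omega>))" if k: "k \<ge> 1" for k
  proof (rule quadratic_growth_integrable[OF F_diff A3_F wstar_argmin w_meas[OF k]])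
    have "(\<lambda>\<omega>. norm (w k \<omega> - wstar)) \<in> borel_measurable P"
      using w_meas[OF k] by measurable
    then show "integrable P (\<lambda>\<omega>. norm (w k \<omega> - wstar) ^ 2)"
      using A6[OF k] t by (intro moment_bounds_from_cube(3)[of _ t]) auto
  qed
  have step: "integrable P (\<lambda>\<omega>. norm (grad F (w k \<omega>)) ^ 2)"
    "\<alpha> k * e k \<le> expectation (\<lambda>\<omega>. F (w k \<omega>)) - expectation (\<lambda>\<omega>. F (w (k + 1) \<omega>)) + B * \<alpha> k ^ 2"
    if k: "k \<ge> 1" for k
  proof -
    have *: "integrable P (\<lambda>\<omega>. g v (\<xi>s k \<omega>))" "expectation (\<lambda>\<omega>. g v (\<xi>s k \<omega>)) = grad F v" for v
      using transfer_integrable[OF k gv] transfer_expectation[OF k gv] A2_integrable[of v] A2[of v]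
      by (simp_all add: g_def)
    have nm: "(\<lambda>s. norm (g v s) ^ 2) \<in> borel_measurable S" for v
      by measurable
    have **: "integrable P (\<lambda>\<omega>. norm (g v (\<xi>s k \<omega>)) ^ 2)"
      "expectation (\<lambda>\<omega>. norm (g v (\<xi>s k \<omega>)) ^ 2) \<le> a * norm (v - wstar) ^ 2 + b" for v
      using transfer_integrable[OF k nm] transfer_expectation[OF k nm] g_sq g_sq_le by simp_all
    have ab: "a \<ge> 0" "b \<ge> 0" by (simp_all add: a_def b_def)
    have cube: "integrable P (\<lambda>\<omega>. norm (w k \<omega> - wstar) ^ 3)"
      "expectation (\<lambda>\<omega>. norm (w k \<omega> - wstar) ^ 3) \<le> t ^ 3"
      using A6[OF k] t by simp_all
    note pos = step_pos[OF k]
    note res = expected_descent_step[where G = "\<lambda>x. G x (\<alpha> k)" and H = "\<lambda>x. H x (\<alpha> k)" and W' = "w (k + 1)",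
        OF F_diff A3_F wstar_argmin w_meas[OF k] xis[OF k] law[OF k] g * ** ab A3_L A1_const(2) pos t(1) cube
          GH[OF pos] A1_G[OF pos] A1_H[OF pos]]
    have w': "w (k + 1) \<omega> = w k \<omega> - \<alpha> k *\<^sub>R G (g (w k \<omega>) (\<xi>s k \<omega>)) (\<alpha> k)" if "\<omega> \<in> space P" for \<omega>
      using w_step[OF k that] by (simp add: g_def)
    \<comment> \<open>The moment bound at index \<open>k + 1\<close> supplies this, so it need not
      be propagated through the update.\<close>
    have "integrable P (\<lambda>\<omega>. F (w (k + 1) \<omega>))"
      by (rule Fw_int) simp
    from res[OF w' this]
    show "integrable P (\<lambda>\<omega>. norm (grad F (w k \<omega>)) ^ 2)"
      "\<alpha> k * e k \<le> expectation (\<lambda>\<omega>. F (w k \<omega>)) - expectation (\<lambda>\<omega>. F (w (k + 1) \<omega>)) + B * \<alpha> k ^ 2"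
      unfolding e_def B_def by simp_all
  qed
  \<comment> \<open>The expected objective values cancel except the first, which is deterministic,
    and the last, which is at least \<open>F wstar\<close>.\<close>
  have telescope: "(\<Sum>k=1..K. \<alpha> k * e k) \<le> (F w\<^sub>1 - F wstar) + B * (\<Sum>k=1..K. \<alpha> k ^ 2)" for K
  proof -
    have "(\<Sum>k=1..K. \<alpha> k * e k) \<le>
        expectation (\<lambda>\<omega>. F (w 1 \<omega>)) - expectation (\<lambda>\<omega>. F (w (K + 1) \<omega>)) + B * (\<Sum>k=1..K. \<alpha> k ^ 2)"
    proof (induction K)
      case (Suc K)
      then show ?case
        using step(2)[of "Suc K"] by (simp add: algebra_simps)
    qed simp
    moreover have "expectation (\<lambda>\<omega>. F (w 1 \<omega>)) = F w\<^sub>1"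
      using w_init by (simp add: prob_space cong: Bochner_Integration.integral_cong)
    moreover have "expectation (\<lambda>\<omega>. F wstar) \<le> expectation (\<lambda>\<omega>. F (w (K + 1) \<omega>))"
      using Fw_int wstar_argmin by (intro integral_mono) (auto simp: is_arg_min_linorder)
    ultimately show ?thesis
      by (simp add: prob_space)
  qed
  have bound: "Min (e ` {1..K}) \<le> (F w\<^sub>1 - F wstar) / (\<Sum>k=1..K. \<alpha> k)
      + B * ((\<Sum>k=1..K. \<alpha> k ^ 2) / (\<Sum>k=1..K. \<alpha> k))" if "K \<ge> 1" for K
    using that step_pos telescope by (intro Min_le_weighted_average) auto
  have limit: "(\<lambda>K. Min (e ` {1..K})) \<longlonglongrightarrow> 0"
    if "summable (\<lambda>k. \<alpha> (k + 1) ^ 2)" "filterlim (\<lambda>K. \<Sum>k=1..K. \<alpha> k) at_top sequentially"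
  proof (rule tendsto_sandwich[OF _ _ tendsto_const weighted_average_bound_tendsto_0[OF that]])
    have e: "0 \<le> e k" for k
      by (simp add: e_def)
    \<comment> \<open>At \<open>K = 0\<close> the minimum is over the empty set and carries no
      information, so both bounds are claimed only from \<open>K = 1\<close> on.\<close>
    show "\<forall>\<^sub>F K in sequentially. 0 \<le> Min (e ` {1..K})"
      using eventually_ge_at_top[of 1] by eventually_elim (simp add: e)
    show "\<forall>\<^sub>F K in sequentially. Min (e ` {1..K}) \<le> (F w\<^sub>1 - F wstar) / (\<Sum>k=1..K. \<alpha> k)
      + B * ((\<Sum>k=1..K. \<alpha> k ^ 2) / (\<Sum>k=1..K. \<alpha> k))"
      using eventually_ge_at_top[of 1] by eventually_elim (rule bound)
  qed
  show ?thesis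
    using step(1) bound limit unfolding B_eq e_def by blast
qed

end
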